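(* For any model class $\mathcal{M}$ of tensor networks of fixed order $M$ it holds that $\mathfrak{K}_{\mathcal{M}}=\mathfrak{K}_{\langle\mathcal{M}\rangle}$, where $\langle\mathcal{M}\rangle$ denotes the linear span of $\mathcal{M}$.
   Context: Let $(Y_m,\rho_m)$, $m=1,\dots,M$, be probability spaces, $Y=Y_1\times\cdots\times Y_M$, $\rho=\rho_1\otimes\cdots\otimes\rho_M$, and $\|\cdot\|=\|\cdot\|_{L^2(Y,\rho)}$ (real-valued functions). For a set $A\subseteq L^2(Y,\rho)$ put $U(A):=\{u/\|u\|:u\in A\setminus\{0\}\}$; the variation function of $A$ is $\mathfrak{K}_A(y):=\sup_{a\in U(A)}|a(y)|^2$, $y\in Y$. Model class of tensor networks of order $M$: for each $m$ let $\mathcal{V}_m\subseteq L^2(Y_m,\rho_m)$ be a linear space with finite basis $b_{m,1},\dots,b_{m,n_m}$. A function $v\in\mathcal{V}_1\otimes\cdots\otimes\mathcal{V}_M$ has a coefficient tensor $\boldsymbol{V}\in\mathbb{R}^{n_1\times\cdots\times n_M}$, with $v(y)=\sum_{l_1,\dots,l_M}\boldsymbol{V}(l_1,\dots,l_M)\prod_m b_{m,l_m}(y_m)$. Fix an architecture, i.e. a finite graph in which each mode $m\in\{1,\dots,M\}$ is attached (as a half-edge of dimension $n_m$) to exactly one vertex, together with a rank (bond dimension) $r_e\in\mathbb{N}_{\ge1}$ for every edge $e$. The model class $\mathcal{M}$ is the set of all $v$ whose coefficient tensor can be obtained by choosing at every vertex a real component tensor (with one index of dimension $r_e$ for every incident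 edge $e$ and one index of dimension $n_m$ for every attached mode $m$) and summing the product of all component tensors over all edge indices. (The tensor train format is the case where the graph is a path with one mode per vertex.) Then $\langle\mathcal{M}\rangle=\mathcal{V}_1\otimes\cdots\otimes\mathcal{V}_M$. *)

theory Defs
  imports "HOL-Probability.Probability" "HOL-Library.Function_Algebras"
begin

text \<open>
  Elements of \<open>L\<^sup>2\<close> are represented by concrete functions, because the variation function
  evaluates them pointwise. ``Zero in \<open>L\<^sup>2\<close>'' therefore means zero almost everywhere.
\<close>

definition L2_funs :: "'a measure \<Rightarrow> ('a \<Rightarrow> real) set" where
  "L2_funs \<mu> = {f \<in> borel_measurable \<mu>. integrable \<mu> (\<lambda>y. (f y)\<^sup>2)}"

definition norm_L2 :: "'a measure \<Rightarrow> ('a \<Rightarrow> real) \<Rightarrow> real" where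
  "norm_L2 \<mu> f = sqrt (LINT y|\<mu>. (f y)\<^sup>2)"

definition normalized :: "'a measure \<Rightarrow> ('a \<Rightarrow> real) set \<Rightarrow> ('a \<Rightarrow> real) set" where
  "normalized \<mu> A = {(\<lambda>y. u y / norm_L2 \<mu> u) | u. u \<in> A \<and> \<not> (AE y in \<mu>. u y = 0)}"

text \<open>
  The supremum is taken in \<open>[0, \<infinity>]\<close>; in particular it is \<open>0\<close> if there is nothing to normalize.
\<close>

definition variation_fun :: "'a measure \<Rightarrow> ('a \<Rightarrow> real) set \<Rightarrow> 'a \<Rightarrow> ennreal" where
  "variation_fun \<mu> A y = (SUP a \<in> normalized \<mu> A. ennreal (\<bar>a y\<bar>\<^sup>2))"

definition fun_scale :: "real \<Rightarrow> ('a \<Rightarrow> real) \<Rightarrow> 'a \<Rightarrow> real" where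
  "fun_scale c f = (\<lambda>y. c * f y)"

global_interpretation fun_space: vector_space "fun_scale :: real \<Rightarrow> ('a \<Rightarrow> real) \<Rightarrow> 'a \<Rightarrow> real"
  by unfold_locales (auto simp: fun_scale_def fun_eq_iff algebra_simps)

text \<open>
  Linear independence is required in \<open>L\<^sup>2\<close>, that is, modulo functions that vanish almost
  everywhere.
\<close>

definition L2_basis ::
  "'a measure \<Rightarrow> ('a \<Rightarrow> real) set \<Rightarrow> nat \<Rightarrow> (nat \<Rightarrow> 'a \<Rightarrow> real) \<Rightarrow> bool" where
  "L2_basis \<mu> V n b \<longleftrightarrow>
     V = fun_space.span (b ` {1..n}) \<and>
     (\<forall>c. (AE y in \<mu>. (\<Sum>l = 1..n. c l * b l y) = 0) \<longrightarrow> (\<forall>l \<in> {1..n}. c l = 0))"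

text \<open>
  An index of a tensor is a function assigning a value to every mode (or edge) of the tensor; it is
  \<^const>\<open>undefined\<close> elsewhere.
\<close>

definition tensor_indices :: "'i set \<Rightarrow> ('i \<Rightarrow> nat) \<Rightarrow> ('i \<Rightarrow> nat) set" where
  "tensor_indices I n = (\<Pi>\<^sub>E i \<in> I. {1..n i})"

definition tensor_fun ::
  "nat \<Rightarrow> (nat \<Rightarrow> nat) \<Rightarrow> (nat \<Rightarrow> nat \<Rightarrow> 'a \<Rightarrow> real) \<Rightarrow> ((nat \<Rightarrow> nat) \<Rightarrow> real)
    \<Rightarrow> (nat \<Rightarrow> 'a) \<Rightarrow> real" where
  "tensor_fun M n b T =
     (\<lambda>y. \<Sum>l \<in> tensor_indices {1..M} n. T l * (\<Prod>m = 1..M. b m (l m) (y m)))"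

text \<open>
  The graph may have parallel edges. An edge whose set of end points is a singleton is a loop; as
  for every other edge, the component tensor at its vertex carries one index for it. Using two
  indices that are set equal would yield the same model class.
\<close>

record ('v, 'e) architecture =
  verts :: "'v set"
  edges :: "'e set"
  ends :: "'e \<Rightarrow> 'v set"
  bond :: "'e \<Rightarrow> nat"
  site :: "nat \<Rightarrow> 'v"

definition tn_architecture :: "nat \<Rightarrow> ('v, 'e) architecture \<Rightarrow> bool" where
  "tn_architecture M G \<longleftrightarrow>
     finite (verts G) \<and> finite (edges G) \<and>
     (\<forall>e \<in> edges G. ends G e \<subseteq> verts G \<and> card (ends G e) \<in> {1, 2} \<and> 1 \<le> bond G e) \<and>
     (\<forall>m \<in> {1..M}. site G m \<in> verts G)"

definition incident :: "('v, 'e) architecture \<Rightarrow> 'v \<Rightarrow> 'e set" where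
  "incident G v = {e \<in> edges G. v \<in> ends G e}"

definition attached :: "nat \<Rightarrow> ('v, 'e) architecture \<Rightarrow> 'v \<Rightarrow> nat set" where
  "attached M G v = {m \<in> {1..M}. site G m = v}"

text \<open>
  The component tensor at \<open>v\<close> only sees the indices of the edges incident with \<open>v\<close> and of the modes
  attached to \<open>v\<close>; this is enforced by the restrictions.
\<close>

definition contraction ::
  "nat \<Rightarrow> ('v, 'e) architecture \<Rightarrow> ('v \<Rightarrow> ('e \<Rightarrow> nat) \<Rightarrow> (nat \<Rightarrow> nat) \<Rightarrow> real)
    \<Rightarrow> (nat \<Rightarrow> nat) \<Rightarrow> real" where
  "contraction M G C l =
     (\<Sum>k \<in> tensor_indices (edges G) (bond G).
        \<Prod>v \<in> verts G. C v (restrict k (incident G v)) (restrict l (attached M G v)))"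

definition tn_model_class ::
  "nat \<Rightarrow> (nat \<Rightarrow> nat) \<Rightarrow> (nat \<Rightarrow> nat \<Rightarrow> 'a \<Rightarrow> real) \<Rightarrow> ('v, 'e) architecture
    \<Rightarrow> ((nat \<Rightarrow> 'a) \<Rightarrow> real) set" where
  "tn_model_class M n b G = {tensor_fun M n b (contraction M G C) | C. True}"

end

theory Submission
  imports Defs
begin

text \<open>
  For a finite-dimensional space \<open>W\<close> of functions, let \<open>K\<close> be the element of \<open>W\<close> that represents
  evaluation at \<open>y\<close>, so that \<open>u y = \<langle>u, K\<rangle>\<close> for all \<open>u\<close> in \<open>W\<close>. The Cauchy--Schwarz inequality gives
  \<open>(u y)\<^sup>2 / \<parallel>u\<parallel>\<^sup>2 \<le> \<parallel>K\<parallel>\<^sup>2\<close>, and \<open>u = K\<close> attains the bound, because \<open>K y = \<parallel>K\<parallel>\<^sup>2\<close>. Hence the variation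
  function at \<open>y\<close> of every subset of \<open>W\<close> that contains \<open>K\<close> agrees with that of \<open>W\<close>
  (\<open>normalized_value_le_variation_fun\<close>).

  On a tensor product of spaces, \<open>K\<close> is the product of the representers \<open>k m\<close> of evaluation at \<open>y m\<close>
  in the single factors, by Fubini's theorem (\<open>tensor_fun_reproduced\<close>). It is thus of rank one, and
  every tensor network contains the functions of rank one: let only the value 1 of each edge index
  contribute (\<open>rank_one_in_tn_model_class\<close>). This \<open>K\<close> depends on \<open>y\<close>, which is harmless, since
  the two suprema are compared at one point at a time.

  The representers \<open>k m\<close> are found by solving a linear system with the Gram matrix of the basis
  (\<open>L2_inner_representer_exists\<close>). The Gram matrix is definite because the basis functions are
  independent modulo null functions. This is also why evaluation at a point can be an
  inner product at all: a function in the space that vanishes almost everywhere has to vanish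
  everywhere.
\<close>

section \<open>Solvability of definite linear systems\<close>

text \<open>
  The induction on the index set is Gram--Schmidt orthogonalization in coordinates, for
  the bilinear form with matrix \<open>A\<close>. Definiteness,
  unlike invertibility, is inherited by principal submatrices, which is what makes the induction
  hypothesis applicable.
\<close>

lemma definite_system_solvable:
  fixes A :: "'i \<Rightarrow> 'i \<Rightarrow> real"
  assumes "finite I"
    and definite: "\<And>c. (\<Sum>i\<in>I. \<Sum>j\<in>I. c i * A i j * c j) = 0 \<Longrightarrow> \<forall>i\<in>I. c i = 0"
  shows "\<exists>c. \<forall>i\<in>I. (\<Sum>j\<in>I. A i j * c j) = d i"
  using assms
proof (induction I arbitrary: d rule: finite_induct)
  case empty
  then show ?case by simp
next
  case (insert a I)
  have IH: "\<exists>c. \<forall>i\<in>I. (\<Sum>j\<in>I. A i j * c j) = d' i" for d'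
  proof (rule insert.IH)
    fix c assume c: "(\<Sum>i\<in>I. \<Sum>j\<in>I. c i * A i j * c j) = 0"
    have eq: "(\<Sum>j\<in>I. (c(a := 0)) i * A i j * (c(a := 0)) j) = (\<Sum>j\<in>I. c i * A i j * c j)"
      if "i \<in> I" for i
      using that insert.hyps by (intro sum.cong) auto
    have "(\<Sum>i\<in>insert a I. \<Sum>j\<in>insert a I. (c(a := 0)) i * A i j * (c(a := 0)) j) = 0"
      using insert.hyps c eq by (simp cong: sum.cong)
    from insert.prems(1)[OF this] show "\<forall>i\<in>I. c i = 0"
      using insert.hyps by (metis fun_upd_other insertI2)
  qed
  obtain q where q: "\<forall>i\<in>I. (\<Sum>j\<in>I. A i j * q j) = A i a"
    using IH[of "\<lambda>i. A i a"] by blast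
  \<comment> \<open>\<open>w\<close> is the new basis vector \<open>a\<close> minus its projection \<open>q\<close> onto the old ones, so that adding
     multiples of it affects the equation for \<open>a\<close> only.\<close>
  define w where "w = (\<lambda>j. if j = a then 1 else - q j)"
  have w_sum: "(\<Sum>j\<in>insert a I. A i j * w j) = A i a - (\<Sum>j\<in>I. A i j * q j)" for i
  proof -
    have "(\<Sum>j\<in>I. A i j * w j) = (\<Sum>j\<in>I. - (A i j * q j))"
      using insert.hyps by (intro sum.cong) (auto simp: w_def)
    then show ?thesis using insert.hyps by (simp add: w_def sum_negf)
  qed
  have w_orth: "(\<Sum>j\<in>insert a I. A i j * w j) = 0" if "i \<in> I" for i
    using that q w_sum by simp
  define s where "s = (\<Sum>j\<in>insert a I. A a j * w j)"
  have "s \<noteq> 0"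
  proof
    assume "s = 0"
    then have "(\<Sum>j\<in>insert a I. A i j * w j) = 0" if "i \<in> insert a I" for i
      using that w_orth unfolding s_def by (cases "i = a") (simp, blast)
    then have "(\<Sum>i\<in>insert a I. w i * (\<Sum>j\<in>insert a I. A i j * w j)) = 0"
      by (intro sum.neutral) (metis mult_zero_right)
    then have "(\<Sum>i\<in>insert a I. \<Sum>j\<in>insert a I. w i * A i j * w j) = 0"
      unfolding sum_distrib_left mult.assoc .
    from insert.prems(1)[OF this] show False by (simp add: w_def)
  qed
  \<comment> \<open>Solve the old equations by \<open>p\<close>, and correct the new one by a multiple of \<open>w\<close>.\<close>
  obtain p where p: "\<forall>i\<in>I. (\<Sum>j\<in>I. A i j * p j) = d i"
    using IH[of d] by blast
  define t where "t = (d a - (\<Sum>j\<in>I. A a j * p j)) / s"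
  define c where "c = (\<lambda>j. (if j = a then 0 else p j) + t * w j)"
  have c_sum: "(\<Sum>j\<in>insert a I. A i j * c j)
      = (\<Sum>j\<in>I. A i j * p j) + t * (\<Sum>j\<in>insert a I. A i j * w j)" for i
  proof -
    have "(\<Sum>j\<in>insert a I. A i j * c j)
        = (\<Sum>j\<in>insert a I. A i j * (if j = a then 0 else p j))
          + (\<Sum>j\<in>insert a I. t * (A i j * w j))"
      unfolding sum.distrib[symmetric] by (simp add: c_def algebra_simps)
    also have "(\<Sum>j\<in>insert a I. A i j * (if j = a then 0 else p j)) = (\<Sum>j\<in>I. A i j * p j)"
      using insert.hyps by (auto intro!: sum.cong)
    finally show ?thesis by (simp only: sum_distrib_left)
  qed
  have "(\<Sum>j\<in>insert a I. A i j * c j) = d i" if "i \<in> insert a I" for i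
  proof (cases "i = a")
    case True
    have "(\<Sum>j\<in>insert a I. A a j * c j) = (\<Sum>j\<in>I. A a j * p j) + t * s"
      using c_sum s_def by simp
    then show ?thesis using \<open>s \<noteq> 0\<close> True by (simp add: t_def)
  next
    case False
    then show ?thesis using that c_sum[of i] w_orth p by simp
  qed
  then show ?case by blast
qed

section \<open>Square integrable functions and representers\<close>

lemma L2_funs_mult_integrable:
  assumes "f \<in> L2_funs \<mu>" "g \<in> L2_funs \<mu>"
  shows "integrable \<mu> (\<lambda>x. f x * g x)"
proof (rule Bochner_Integration.integrable_bound)
  show "integrable \<mu> (\<lambda>x. (f x)\<^sup>2 + (g x)\<^sup>2)"
    using assms by (simp add: L2_funs_def)
  show "(\<lambda>x. f x * g x) \<in> borel_measurable \<mu>"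
    using assms by (auto simp: L2_funs_def)
  have "\<bar>p * q\<bar> \<le> p\<^sup>2 + q\<^sup>2" for p q :: real
  proof -
    have "0 \<le> (\<bar>p\<bar> - \<bar>q\<bar>)\<^sup>2" by simp
    then have "2 * (\<bar>p\<bar> * \<bar>q\<bar>) \<le> p\<^sup>2 + q\<^sup>2" by (simp add: power2_diff)
    moreover have "0 \<le> \<bar>p\<bar> * \<bar>q\<bar>" by simp
    ultimately show ?thesis unfolding abs_mult by linarith
  qed
  then show "AE x in \<mu>. norm (f x * g x) \<le> norm ((f x)\<^sup>2 + (g x)\<^sup>2)"
    by (intro AE_I2) simp
qed

lemma L2_funs_add:
  assumes "f \<in> L2_funs \<mu>" "g \<in> L2_funs \<mu>"
  shows "(\<lambda>x. f x + g x) \<in> L2_funs \<mu>"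
proof -
  have "integrable \<mu> (\<lambda>x. (f x)\<^sup>2 + (g x)\<^sup>2 + 2 * (f x * g x))"
    using assms L2_funs_mult_integrable[OF assms] by (simp add: L2_funs_def)
  then show ?thesis
    using assms by (auto simp: L2_funs_def power2_sum mult.assoc)
qed

lemma L2_funs_scale: "f \<in> L2_funs \<mu> \<Longrightarrow> (\<lambda>x. c * f x) \<in> L2_funs \<mu>"
  by (auto simp: L2_funs_def power_mult_distrib)

lemma L2_funs_sum:
  "(\<And>i. i \<in> I \<Longrightarrow> f i \<in> L2_funs \<mu>) \<Longrightarrow> (\<lambda>x. \<Sum>i\<in>I. f i x) \<in> L2_funs \<mu>"
proof (induction I rule: infinite_finite_induct)
  case (insert i I)
  then show ?case using L2_funs_add[of "f i" \<mu> "\<lambda>x. \<Sum>i\<in>I. f i x"] by simp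
qed (simp_all add: L2_funs_def)

text \<open>
  Every linear functional on the span of \<open>b\<close> is an inner product with an element of that span. The
  functional is given by its values \<open>d\<close> on the basis, and the coefficients of the representer solve
  the linear system of the Gram matrix.
\<close>

lemma L2_inner_representer_exists:
  assumes "finite I"
    and L2: "\<And>i. i \<in> I \<Longrightarrow> b i \<in> L2_funs \<mu>"
    and indep: "\<And>c. (AE x in \<mu>. (\<Sum>i\<in>I. c i * b i x) = 0) \<Longrightarrow> \<forall>i\<in>I. c i = 0"
  shows "\<exists>c. \<forall>i\<in>I. (LINT x|\<mu>. b i x * (\<Sum>j\<in>I. c j * b j x)) = d i"
proof -
  define A where "A = (\<lambda>i j. LINT x|\<mu>. b i x * b j x)"
  have int: "integrable \<mu> (\<lambda>x. b i x * b j x)" if "i \<in> I" "j \<in> I" for i j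
    using that L2 L2_funs_mult_integrable by blast
  have row: "(LINT x|\<mu>. b i x * (\<Sum>j\<in>I. c j * b j x)) = (\<Sum>j\<in>I. A i j * c j)" if "i \<in> I" for i c
  proof -
    have "(LINT x|\<mu>. b i x * (\<Sum>j\<in>I. c j * b j x)) = (LINT x|\<mu>. (\<Sum>j\<in>I. c j * (b i x * b j x)))"
      by (simp add: sum_distrib_left mult.left_commute)
    also have "\<dots> = (\<Sum>j\<in>I. (LINT x|\<mu>. c j * (b i x * b j x)))"
      using int that by (intro Bochner_Integration.integral_sum) auto
    finally show ?thesis by (simp add: A_def mult.commute)
  qed
  have "\<exists>c. \<forall>i\<in>I. (\<Sum>j\<in>I. A i j * c j) = d i"
  proof (rule definite_system_solvable[OF \<open>finite I\<close>])
    fix c assume 0: "(\<Sum>i\<in>I. \<Sum>j\<in>I. c i * A i j * c j) = 0"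
    define f where "f = (\<lambda>x. \<Sum>i\<in>I. c i * b i x)"
    have f: "f \<in> L2_funs \<mu>"
      unfolding f_def using L2 by (intro L2_funs_sum L2_funs_scale)
    have "(LINT x|\<mu>. (f x)\<^sup>2) = (LINT x|\<mu>. (\<Sum>i\<in>I. c i * (b i x * f x)))"
      by (simp add: power2_eq_square sum_distrib_right mult.assoc f_def)
    also have "\<dots> = (\<Sum>i\<in>I. (LINT x|\<mu>. c i * (b i x * f x)))"
      using L2 f L2_funs_mult_integrable by (intro Bochner_Integration.integral_sum) auto
    also have "\<dots> = (\<Sum>i\<in>I. c i * (\<Sum>j\<in>I. A i j * c j))"
      using row by (auto simp: f_def intro!: sum.cong)
    also have "\<dots> = 0"
      using 0 by (simp add: sum_distrib_left mult.assoc)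
    finally have "(LINT x|\<mu>. (f x)\<^sup>2) = 0" .
    then have "AE x in \<mu>. f x = 0"
      using f integral_nonneg_eq_0_iff_AE[of \<mu> "\<lambda>x. (f x)\<^sup>2"] by (simp add: L2_funs_def)
    then show "\<forall>i\<in>I. c i = 0" using indep by (simp add: f_def)
  qed
  then show ?thesis using row by auto
qed

text \<open>
  The class \<open>A\<close> enters only through its element \<open>k\<close>: the bound that the Cauchy--Schwarz inequality
  gives for the normalized \<open>u\<close> is the value that \<open>k\<close> itself attains. If \<open>k\<close> vanishes almost
  everywhere, it cannot be normalized, but then \<open>u y = 0\<close>.
\<close>

lemma normalized_value_le_variation_fun:
  assumes u: "u \<in> L2_funs \<mu>" "\<not> (AE x in \<mu>. u x = 0)"
    and k: "k \<in> L2_funs \<mu>" "k \<in> A"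
    and uk: "u y = (LINT x|\<mu>. u x * k x)"
    and kk: "k y = (LINT x|\<mu>. (k x)\<^sup>2)"
  shows "ennreal (\<bar>u y / norm_L2 \<mu> u\<bar>\<^sup>2) \<le> variation_fun \<mu> A y"
proof -
  define U where "U = (LINT x|\<mu>. (u x)\<^sup>2)"
  have int: "integrable \<mu> (\<lambda>x. (u x)\<^sup>2)" "integrable \<mu> (\<lambda>x. (k x)\<^sup>2)"
      "integrable \<mu> (\<lambda>x. u x * k x)"
    using u k L2_funs_mult_integrable by (auto simp: L2_funs_def)
  have "U \<noteq> 0"
    using u(2) int(1) integral_nonneg_eq_0_iff_AE[of \<mu> "\<lambda>x. (u x)\<^sup>2"] by (simp add: U_def)
  moreover have "0 \<le> U" by (simp add: U_def)
  ultimately have U: "0 < U" by simp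
  have norm_u: "\<bar>u y / norm_L2 \<mu> u\<bar>\<^sup>2 = (u y)\<^sup>2 / U"
    using U by (simp add: norm_L2_def U_def power_divide)
  show ?thesis
  proof (cases "AE x in \<mu>. k x = 0")
    case True
    then have "u y = 0"
      unfolding uk by (intro integral_eq_zero_AE) auto
    then show ?thesis by simp
  next
    case False
    have "0 \<le> k y" by (simp add: kk)
    moreover have "k y \<noteq> 0"
      using False int(2) integral_nonneg_eq_0_iff_AE[of \<mu> "\<lambda>x. (k x)\<^sup>2"] by (simp add: kk)
    ultimately have pos: "0 < k y" by simp
    have norm_k: "\<bar>k y / norm_L2 \<mu> k\<bar>\<^sup>2 = k y"
      using pos by (simp add: norm_L2_def kk[symmetric] power_divide) (simp add: power2_eq_square)
    \<comment> \<open>Up to the factor \<open>k y\<close>, this is the component of \<open>u\<close> orthogonal to \<open>k\<close>.\<close>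
    have "0 \<le> (LINT x|\<mu>. (k y * u x - u y * k x)\<^sup>2)" by simp
    also have "\<dots> = (LINT x|\<mu>. (k y)\<^sup>2 * (u x)\<^sup>2 - 2 * k y * u y * (u x * k x) + (u y)\<^sup>2 * (k x)\<^sup>2)"
      by (simp add: power2_diff power_mult_distrib algebra_simps)
    also have "\<dots> = (k y)\<^sup>2 * U - 2 * k y * u y * u y + (u y)\<^sup>2 * k y"
      using int by (simp add: U_def uk[symmetric] kk[symmetric])
    also have "\<dots> = k y * (k y * U - (u y)\<^sup>2)"
      by (simp add: power2_eq_square algebra_simps)
    finally have "(u y)\<^sup>2 \<le> k y * U"
      using pos by (simp add: zero_le_mult_iff)
    then have "(u y)\<^sup>2 / U \<le> k y"
      using U by (simp add: divide_le_eq)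
    then have "ennreal (\<bar>u y / norm_L2 \<mu> u\<bar>\<^sup>2) \<le> ennreal (\<bar>k y / norm_L2 \<mu> k\<bar>\<^sup>2)"
      unfolding norm_u norm_k by (rule ennreal_leI)
    also have "\<dots> \<le> variation_fun \<mu> A y"
      unfolding variation_fun_def using k(2) False
      by (intro SUP_upper2[of "\<lambda>x. k x / norm_L2 \<mu> k"]) (auto simp: normalized_def)
    finally show ?thesis .
  qed
qed

section \<open>Rank-one functions and tensor networks\<close>

lemma product_of_sums_eq_tensor_fun:
  "(\<lambda>y. \<Prod>m = 1..M. \<Sum>l = 1..n m. c m l * b m l (y m))
    = tensor_fun M n b (\<lambda>l. \<Prod>m = 1..M. c m (l m))"
  by (simp add: tensor_fun_def tensor_indices_def fun_eq_iff prod_sum_PiE prod.distrib)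

text \<open>
  Take components that vanish unless all their edge indices are 1. As every edge has an end point, only
  the all-ones assignment contributes to the contraction, whatever the graph and the ranks are, and
  it leaves one factor for every mode, collected at the vertex to which the mode is attached.
\<close>

lemma rank_one_contraction:
  assumes G: "tn_architecture M G"
  shows "\<exists>C. \<forall>l. contraction M G C l = (\<Prod>m = 1..M. c m (l m))"
proof (intro exI allI)
  define C where "C = (\<lambda>v k l. if \<forall>e\<in>incident G v. k e = (1::nat)
    then \<Prod>m\<in>attached M G v. c m (l m) else 0)"
  fix l
  define one where "one = restrict (\<lambda>e. 1::nat) (edges G)"
  have fin: "finite (verts G)" "finite (edges G)"
    and ends: "\<And>e. e \<in> edges G \<Longrightarrow> ends G e \<subseteq> verts G \<and> ends G e \<noteq> {} \<and> 1 \<le> bond G e"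
    and site: "\<And>m. m \<in> {1..M} \<Longrightarrow> site G m \<in> verts G"
    using G by (auto simp: tn_architecture_def)
  let ?P = "\<lambda>k. \<Prod>v\<in>verts G. C v (restrict k (incident G v)) (restrict l (attached M G v))"
  have one_mem: "one \<in> tensor_indices (edges G) (bond G)"
    using ends by (auto simp: one_def tensor_indices_def)
  have other: "?P k = 0" if "k \<in> tensor_indices (edges G) (bond G) - {one}" for k
  proof -
    have "\<exists>e\<in>edges G. k e \<noteq> one e"
    proof (rule ccontr)
      assume "\<not> ?thesis"
      then have "k = one"
        using that one_mem by (intro PiE_ext[of k _ _ one]) (auto simp: tensor_indices_def)
      then show False using that by simp
    qed
    then obtain e where e: "e \<in> edges G" "k e \<noteq> 1" by (auto simp: one_def)
    then obtain v where v: "v \<in> verts G" "v \<in> ends G e" using ends by blast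
    then have "C v (restrict k (incident G v)) (restrict l (attached M G v)) = 0"
      using e by (auto simp: C_def incident_def)
    with v fin show ?thesis by (auto intro: prod_zero)
  qed
  have "contraction M G C l = (\<Sum>k\<in>tensor_indices (edges G) (bond G). ?P k)"
    by (simp add: contraction_def)
  also have "\<dots> = (\<Sum>k\<in>{one}. ?P k)"
    using fin one_mem other
    by (intro sum.mono_neutral_right) (auto simp: tensor_indices_def intro!: finite_PiE)
  also have "\<dots> = (\<Prod>v\<in>verts G. \<Prod>m\<in>attached M G v. c m (l m))"
    by (auto simp: C_def one_def incident_def intro!: prod.cong)
  also have "\<dots> = (\<Prod>m = 1..M. c m (l m))"
    unfolding attached_def using fin site by (intro prod.group) auto
  finally show "contraction M G C l = (\<Prod>m = 1..M. c m (l m))" .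
qed

lemma rank_one_in_tn_model_class:
  assumes "tn_architecture M G"
  shows "(\<lambda>y. \<Prod>m = 1..M. \<Sum>l = 1..n m. c m l * b m l (y m)) \<in> tn_model_class M n b G"
proof -
  obtain C where "\<forall>l. contraction M G C l = (\<Prod>m = 1..M. c m (l m))"
    using rank_one_contraction[OF assms] by blast
  then have "contraction M G C = (\<lambda>l. \<Prod>m = 1..M. c m (l m))" by auto
  then show ?thesis
    unfolding product_of_sums_eq_tensor_fun tn_model_class_def
    by (intro CollectI exI[of _ C]) simp
qed

text \<open>
  One inclusion of the identity between the span and the full tensor product suffices: whatever
  holds for all functions with a coefficient tensor holds on the span.
\<close>

lemma span_tn_model_class_subset:
  "fun_space.span (tn_model_class M n b G) \<subseteq> range (tensor_fun M n b)"
proof (rule fun_space.span_minimal)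
  show "tn_model_class M n b G \<subseteq> range (tensor_fun M n b)"
    by (auto simp: tn_model_class_def)
  have "tensor_fun M n b (\<lambda>_. 0) = 0"
    by (simp add: tensor_fun_def fun_eq_iff)
  moreover have "tensor_fun M n b S + tensor_fun M n b T = tensor_fun M n b (\<lambda>l. S l + T l)" for S T
    by (simp add: tensor_fun_def fun_eq_iff sum.distrib distrib_right)
  moreover have "fun_scale a (tensor_fun M n b T) = tensor_fun M n b (\<lambda>l. a * T l)" for a T
    by (simp add: tensor_fun_def fun_scale_def fun_eq_iff sum_distrib_left mult.assoc)
  ultimately show "fun_space.subspace (range (tensor_fun M n b))"
    unfolding fun_space.subspace_def by (auto intro: range_eqI[OF sym])
qed

section \<open>Products of square integrable functions\<close>

text \<open>
  Fubini's theorem for products of functions, with assumptions on the factors with index in \<open>I\<close> only.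
\<close>

lemma PiM_product_integral:
  fixes f :: "'i \<Rightarrow> 'a \<Rightarrow> real"
  assumes "finite I" and sf: "\<And>i. i \<in> I \<Longrightarrow> sigma_finite_measure (\<rho> i)"
    and int: "\<And>i. i \<in> I \<Longrightarrow> integrable (\<rho> i) (f i)"
  shows PiM_product_integrable: "integrable (PiM I \<rho>) (\<lambda>x. \<Prod>i\<in>I. f i (x i))"
    and PiM_product_integral_eq: "(LINT x|PiM I \<rho>. (\<Prod>i\<in>I. f i (x i))) = (\<Prod>i\<in>I. (LINT x|\<rho> i. f i x))"
proof -
  \<comment> \<open>A product of measures does not depend on the measures outside \<open>I\<close>, so these may be replaced
     by \<open>\<sigma>\<close>-finite ones.\<close>
  define \<rho>' where "\<rho>' = (\<lambda>i. if i \<in> I then \<rho> i else count_space {})"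
  have P: "PiM I \<rho> = PiM I \<rho>'" by (intro PiM_cong) (auto simp: \<rho>'_def)
  interpret product_sigma_finite \<rho>'
    unfolding product_sigma_finite_def \<rho>'_def
    using sf by (auto intro: sigma_finite_measure_count_space_finite)
  have int': "integrable (\<rho>' i) (f i)" if "i \<in> I" for i
    using that int by (simp add: \<rho>'_def)
  show "integrable (PiM I \<rho>) (\<lambda>x. \<Prod>i\<in>I. f i (x i))"
    unfolding P using \<open>finite I\<close> int' by (rule product_integrable_prod)
  have "(LINT x|PiM I \<rho>. (\<Prod>i\<in>I. f i (x i))) = (\<Prod>i\<in>I. (LINT x|\<rho>' i. f i x))"
    unfolding P using \<open>finite I\<close> int' by (rule product_integral_prod)
  then show "(LINT x|PiM I \<rho>. (\<Prod>i\<in>I. f i (x i))) = (\<Prod>i\<in>I. (LINT x|\<rho> i. f i x))"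
    by (simp add: \<rho>'_def)
qed

lemma L2_funs_PiM_product:
  assumes "finite I" and sf: "\<And>i. i \<in> I \<Longrightarrow> sigma_finite_measure (\<rho> i)"
    and f: "\<And>i. i \<in> I \<Longrightarrow> f i \<in> L2_funs (\<rho> i)"
  shows "(\<lambda>x. \<Prod>i\<in>I. f i (x i)) \<in> L2_funs (PiM I \<rho>)"
proof -
  have "(\<lambda>x. f i (x i)) \<in> borel_measurable (PiM I \<rho>)" if "i \<in> I" for i
    using that f[OF that] by (intro measurable_compose[OF measurable_component_singleton])
      (auto simp: L2_funs_def)
  moreover have "integrable (PiM I \<rho>) (\<lambda>x. \<Prod>i\<in>I. (f i (x i))\<^sup>2)"
    using assms by (intro PiM_product_integrable[where f = "\<lambda>i x. (f i x)\<^sup>2"]) (auto simp: L2_funs_def)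
  ultimately show ?thesis
    by (simp add: L2_funs_def prod_power_distrib)
qed

lemma tensor_fun_L2:
  assumes sf: "\<And>m. m \<in> {1..M} \<Longrightarrow> sigma_finite_measure (\<rho> m)"
    and b: "\<And>m l. m \<in> {1..M} \<Longrightarrow> l \<in> {1..n m} \<Longrightarrow> b m l \<in> L2_funs (\<rho> m)"
  shows "tensor_fun M n b T \<in> L2_funs (PiM {1..M} \<rho>)"
  unfolding tensor_fun_def
proof (intro L2_funs_sum L2_funs_scale L2_funs_PiM_product)
  fix l m assume "l \<in> tensor_indices {1..M} n" "m \<in> {1..M}"
  then show "b m (l m) \<in> L2_funs (\<rho> m)"
    using b by (auto simp: tensor_indices_def PiE_def Pi_def)
qed (use sf in auto)

text \<open>
  Evaluation at \<open>y\<close> of a product function is the product of the evaluations at the components of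
  \<open>y\<close>, and likewise the inner product of two product functions factorizes. So the product of the
  representers represents evaluation on product functions, hence on their linear combinations.
\<close>

lemma tensor_fun_reproduced:
  assumes sf: "\<And>m. m \<in> {1..M} \<Longrightarrow> sigma_finite_measure (\<rho> m)"
    and b: "\<And>m l. m \<in> {1..M} \<Longrightarrow> l \<in> {1..n m} \<Longrightarrow> b m l \<in> L2_funs (\<rho> m)"
    and k: "\<And>m. m \<in> {1..M} \<Longrightarrow> k m \<in> L2_funs (\<rho> m)"
    and rep: "\<And>m l. m \<in> {1..M} \<Longrightarrow> l \<in> {1..n m} \<Longrightarrow> (LINT x|\<rho> m. b m l x * k m x) = b m l (y m)"
  shows "(LINT x|PiM {1..M} \<rho>. tensor_fun M n b T x * (\<Prod>m = 1..M. k m (x m))) = tensor_fun M n b T y"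
proof -
  have int: "integrable (\<rho> m) (\<lambda>x. b m (l m) x * k m x)"
    and val: "(LINT x|\<rho> m. b m (l m) x * k m x) = b m (l m) (y m)"
    if "l \<in> tensor_indices {1..M} n" "m \<in> {1..M}" for l m
  proof -
    have "l m \<in> {1..n m}" using that by (auto simp: tensor_indices_def PiE_def Pi_def)
    then show "integrable (\<rho> m) (\<lambda>x. b m (l m) x * k m x)"
      "(LINT x|\<rho> m. b m (l m) x * k m x) = b m (l m) (y m)"
      using that b k rep L2_funs_mult_integrable by blast+
  qed
  have "(LINT x|PiM {1..M} \<rho>. tensor_fun M n b T x * (\<Prod>m = 1..M. k m (x m)))
     = (LINT x|PiM {1..M} \<rho>. (\<Sum>l\<in>tensor_indices {1..M} n.
          T l * (\<Prod>m = 1..M. b m (l m) (x m) * k m (x m))))"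
    by (simp add: tensor_fun_def sum_distrib_right prod.distrib mult.assoc)
  also have "\<dots> = (\<Sum>l\<in>tensor_indices {1..M} n.
          (LINT x|PiM {1..M} \<rho>. T l * (\<Prod>m = 1..M. b m (l m) (x m) * k m (x m))))"
    using sf int by (intro Bochner_Integration.integral_sum integrable_mult_right
      PiM_product_integrable[where f = "\<lambda>m x. b m (_ m) x * k m x"]) auto
  also have "\<dots> = (\<Sum>l\<in>tensor_indices {1..M} n. T l * (\<Prod>m = 1..M. b m (l m) (y m)))"
  proof (intro sum.cong refl)
    fix l assume l: "l \<in> tensor_indices {1..M} n"
    have "(LINT x|PiM {1..M} \<rho>. (\<Prod>m = 1..M. b m (l m) (x m) * k m (x m)))
        = (\<Prod>m = 1..M. (LINT x|\<rho> m. b m (l m) x * k m x))"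
      using sf int[OF l] by (intro PiM_product_integral_eq) auto
    then show "(LINT x|PiM {1..M} \<rho>. T l * (\<Prod>m = 1..M. b m (l m) (x m) * k m (x m)))
        = T l * (\<Prod>m = 1..M. b m (l m) (y m))"
      using val[OF l] by simp
  qed
  finally show ?thesis by (simp add: tensor_fun_def)
qed

section \<open>Equality of the variation functions\<close>

theorem proposition2p11:
  fixes M :: nat
    and \<rho> :: "nat \<Rightarrow> 'a measure"
    and V :: "nat \<Rightarrow> ('a \<Rightarrow> real) set"
    and n :: "nat \<Rightarrow> nat"
    and b :: "nat \<Rightarrow> nat \<Rightarrow> 'a \<Rightarrow> real"
    and G :: "('v, 'e) architecture"
  assumes "\<And>m. m \<in> {1..M} \<Longrightarrow> prob_space (\<rho> m)"
    and "\<And>m. m \<in> {1..M} \<Longrightarrow> V m \<subseteq> L2_funs (\<rho> m)"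
    and "\<And>m. m \<in> {1..M} \<Longrightarrow> L2_basis (\<rho> m) (V m) (n m) (b m)"
    and "tn_architecture M G"
  shows "\<forall>y \<in> space (PiM {1..M} \<rho>).
    variation_fun (PiM {1..M} \<rho>) (tn_model_class M n b G) y =
    variation_fun (PiM {1..M} \<rho>) (fun_space.span (tn_model_class M n b G)) y"
proof (rule ballI, rule antisym)
  fix y
  let ?\<mu> = "PiM {1..M} \<rho>" and ?A = "tn_model_class M n b G"
  have "normalized ?\<mu> ?A \<subseteq> normalized ?\<mu> (fun_space.span ?A)"
    using fun_space.span_superset[of ?A] unfolding normalized_def by blast
  then show "variation_fun ?\<mu> ?A y \<le> variation_fun ?\<mu> (fun_space.span ?A) y"
    unfolding variation_fun_def by (rule SUP_subset_mono) simp
  have sf: "sigma_finite_measure (\<rho> m)" if "m \<in> {1..M}" for m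
    using assms(1)[OF that] by (simp add: prob_space_imp_sigma_finite)
  have b: "b m l \<in> L2_funs (\<rho> m)" if "m \<in> {1..M}" "l \<in> {1..n m}" for m l
    using assms(2,3)[OF that(1)] that(2) fun_space.span_base[of "b m l" "b m ` {1..n m}"]
    by (auto simp: L2_basis_def)
  have "\<exists>c. \<forall>l\<in>{1..n m}. (LINT x|\<rho> m. b m l x * (\<Sum>j = 1..n m. c j * b m j x)) = b m l (y m)"
    if "m \<in> {1..M}" for m
    using assms(3)[OF that] b[OF that]
    by (intro L2_inner_representer_exists) (auto simp: L2_basis_def)
  then obtain c where c: "(LINT x|\<rho> m. b m l x * (\<Sum>j = 1..n m. c m j * b m j x)) = b m l (y m)"
    if "m \<in> {1..M}" "l \<in> {1..n m}" for m l
    by metis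
  define k where "k = (\<lambda>m x. \<Sum>j = 1..n m. c m j * b m j x)"
  define K where "K = (\<lambda>x. \<Prod>m = 1..M. k m (x m))"
  have k: "k m \<in> L2_funs (\<rho> m)" if "m \<in> {1..M}" for m
    unfolding k_def using b[OF that] by (intro L2_funs_sum L2_funs_scale) auto
  have c': "(LINT x|\<rho> m. b m l x * k m x) = b m l (y m)"
    if "m \<in> {1..M}" "l \<in> {1..n m}" for m l
    using c[OF that] by (simp add: k_def)
  have K_mem: "K \<in> ?A"
    unfolding K_def k_def by (rule rank_one_in_tn_model_class[OF assms(4)])
  have K_eq: "K = tensor_fun M n b (\<lambda>l. \<Prod>m = 1..M. c m (l m))"
    unfolding K_def k_def by (rule product_of_sums_eq_tensor_fun)
  have tensor_L2: "tensor_fun M n b T \<in> L2_funs ?\<mu>" for T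
    using sf b by (rule tensor_fun_L2)
  have reproduced: "tensor_fun M n b T y = (LINT x|?\<mu>. tensor_fun M n b T x * K x)" for T
    unfolding K_def using tensor_fun_reproduced[OF sf b k c', where T = T] by simp
  have K_y: "K y = (LINT x|?\<mu>. (K x)\<^sup>2)"
    using reproduced[of "\<lambda>l. \<Prod>m = 1..M. c m (l m)"] unfolding K_eq[symmetric] power2_eq_square .
  show "variation_fun ?\<mu> (fun_space.span ?A) y \<le> variation_fun ?\<mu> ?A y"
    unfolding variation_fun_def[of _ "fun_space.span ?A"]
  proof (rule SUP_least)
    fix a assume "a \<in> normalized ?\<mu> (fun_space.span ?A)"
    then obtain u where u: "u \<in> fun_space.span ?A" "\<not> (AE x in ?\<mu>. u x = 0)"
        "a = (\<lambda>x. u x / norm_L2 ?\<mu> u)"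
      unfolding normalized_def by blast
    then obtain T where "u = tensor_fun M n b T"
      using span_tn_model_class_subset[of M n b G] by blast
    then have "ennreal (\<bar>u y / norm_L2 ?\<mu> u\<bar>\<^sup>2) \<le> variation_fun ?\<mu> ?A y"
      using u(2) tensor_L2 reproduced K_mem K_y K_eq
      by (intro normalized_value_le_variation_fun[where k = K]) auto
    then show "ennreal (\<bar>a y\<bar>\<^sup>2) \<le> variation_fun ?\<mu> ?A y" using u(3) by simp
  qed
qed

end
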